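(* Let $n\ge1$ and let $\lambda\in\mathbb{Z}^n$ with $\lambda_1\ge\cdots\ge\lambda_n$. Let $W_\lambda=\{v\in S_n: v\lambda=\lambda\}$ be the stabilizer of $\lambda$ in $S_n$, let $W_\lambda(t)=\sum_{w\in W_\lambda}t^{\ell(w)}$ be its length generating function, and let $w_\lambda$ be the longest element of $W_\lambda$. Then $$t^{-\frac12\ell(w_\lambda)}W_\lambda(t)=\mathrm{ev}^t_0(c^Y_{w_\lambda})=\sum_{w\in W_\lambda}w\,c^{X^{-1}}_{w_\lambda}.$$ Alternatively, $$W_\lambda(t)=\sum_{w\in W_\lambda}w\Big(\prod_{1\le i<j\le n,\ \lambda_i=\lambda_j}\frac{1-tx_i^{-1}x_j}{1-x_i^{-1}x_j}\Big)=\prod_{1\le i<j\le n,\ \lambda_i=\lambda_j}\frac{1-t^{j-i+1}}{1-t^{j-i}}=\prod_{i\in\mathbb{Z}}[m_i]!,$$ where $m_i=\#\{k\in\{1,\ldots,n\}:\lambda_k=i\}$ and $[m]!=\prod_{d=1}^m\frac{1-t^d}{1-t}$.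
   Context: $t^{1/2}$ is an indeterminate over $\mathbb{C}$, $t=(t^{1/2})^2$; $\ell$ is the length function of $S_n$; $S_n$ acts on $\mathbb{Z}^n$ by permuting positions and on functions of $x_1,\ldots,x_n$ by permuting the variables. In commuting variables $x_1,\ldots,x_n$ and $Y_1,\ldots,Y_n$, $$c^{X^{-1}}_{w_\lambda}=\prod_{1\le i<j\le n,\ \lambda_i=\lambda_j}\frac{t^{-\frac12}-t^{\frac12}x_i^{-1}x_j}{1-x_i^{-1}x_j},\qquad c^Y_{w_\lambda}=\prod_{1\le i<j\le n,\ \lambda_i=\lambda_j}\frac{t^{-\frac12}-t^{\frac12}Y_iY_j^{-1}}{1-Y_iY_j^{-1}},$$ and $\mathrm{ev}^t_0$ is the evaluation $Y_i\mapsto t^{-(i-1)+\frac12(n-1)}$. *)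

theory Defs
  imports
    Complex_Main
    "HOL-Computational_Algebra.Polynomial"
    "HOL-Computational_Algebra.Fraction_Field"
    "HOL-Library.Poly_Mapping"
    "HOL-Library.Groups_Big_Fun"
    "HOL-Combinatorics.Permutations"
begin

section \<open>Symmetric group\<close>

text \<open>
  Elements of \<open>S_n\<close> are functions \<open>w :: nat \<Rightarrow> nat\<close> with \<open>w permutes {1..n}\<close>, and an element of
  \<open>\<int>^n\<close> is represented by a function \<open>nat \<Rightarrow> int\<close> of which only the values on \<open>{1..n}\<close> are used.
\<close>

definition perm_length :: "nat \<Rightarrow> (nat \<Rightarrow> nat) \<Rightarrow> nat" where
  "perm_length n w = card {(i, j). 1 \<le> i \<and> i < j \<and> j \<le> n \<and> w j < w i}"

text \<open>The left action by permuting positions: the entry of \<open>mu\<close> at position \<open>i\<close> moves to \<open>v i\<close>.\<close>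

definition perm_positions :: "(nat \<Rightarrow> nat) \<Rightarrow> (nat \<Rightarrow> int) \<Rightarrow> (nat \<Rightarrow> int)" where
  "perm_positions v mu = (\<lambda>i. mu (inv v i))"

definition stabilizer :: "nat \<Rightarrow> (nat \<Rightarrow> int) \<Rightarrow> (nat \<Rightarrow> nat) set" where
  "stabilizer n lam =
     {v. v permutes {1..n} \<and> (\<forall>i\<in>{1..n}. perm_positions v lam i = lam i)}"

definition longest_stab :: "nat \<Rightarrow> (nat \<Rightarrow> int) \<Rightarrow> (nat \<Rightarrow> nat)" where
  "longest_stab n lam = (ARG_MAX (perm_length n) w. w \<in> stabilizer n lam)"

definition equal_pairs :: "nat \<Rightarrow> (nat \<Rightarrow> int) \<Rightarrow> (nat \<times> nat) set" where
  "equal_pairs n lam = {(i, j). 1 \<le> i \<and> i < j \<and> j \<le> n \<and> lam i = lam j}"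

section \<open>The field of coefficients and the field of rational functions\<close>

text \<open>
  The coefficient field is \<open>\<complex>(t^{1/2})\<close>.  A polynomial over a field \<open>'a\<close> in variables indexed by
  \<open>nat\<close> is a finitely supported map from exponent vectors to coefficients; only the variables with
  index in \<open>{1..n}\<close> will occur.
\<close>

type_synonym coeff_field = "complex poly fract"

type_synonym 'a multipoly = "(nat \<Rightarrow>\<^sub>0 nat) \<Rightarrow>\<^sub>0 'a"

type_synonym 'a ratfun = "'a multipoly fract"

definition t_half :: coeff_field where
  "t_half = Fract [:0, 1:] 1"

definition t_var :: coeff_field where
  "t_var = t_half ^ 2"

definition const :: "'a::field \<Rightarrow> 'a ratfun" where
  "const c = Fract (Poly_Mapping.single 0 c) 1"

definition indet :: "nat \<Rightarrow> 'a::field ratfun" where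
  "indet i = Fract (Poly_Mapping.single (Poly_Mapping.single i 1) 1) 1"

section \<open>Substitution into rational functions\<close>

text \<open>
  \<open>multipoly_subst h a\<close> applies the field homomorphism \<open>h\<close> to the coefficients and replaces
  the \<open>i\<close>-th variable by \<open>a i\<close>.  Its extension \<open>ratfun_subst h a\<close> to fractions is
  meaningful on those rational functions that have a representation whose denominator does not
  become zero, and then does not depend on the representation (see \<open>ratfun_subst_Fract\<close>).
\<close>

definition multipoly_subst ::
  "('a::field \<Rightarrow> 'b::field) \<Rightarrow> (nat \<Rightarrow> 'b) \<Rightarrow> 'a multipoly \<Rightarrow> 'b" where
  "multipoly_subst h a p =
     (\<Sum>m\<in>Poly_Mapping.keys p. h (Poly_Mapping.lookup p m) *
        (\<Prod>i\<in>Poly_Mapping.keys m. a i ^ Poly_Mapping.lookup m i))"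

definition ratfun_subst ::
  "('a::field \<Rightarrow> 'b::field) \<Rightarrow> (nat \<Rightarrow> 'b) \<Rightarrow> 'a ratfun \<Rightarrow> 'b" where
  "ratfun_subst h a r =
     (THE v. \<exists>p q. multipoly_subst h a q \<noteq> 0 \<and> r = Fract p q \<and>
                   v = multipoly_subst h a p / multipoly_subst h a q)"

lemma multipoly_subst_superset:
  fixes h :: "'a::field \<Rightarrow> 'b::field"
  assumes "h 0 = 0" "finite A" "Poly_Mapping.keys p \<subseteq> A"
  shows "multipoly_subst h a p =
     (\<Sum>m\<in>A. h (Poly_Mapping.lookup p m) *
        (\<Prod>i\<in>Poly_Mapping.keys m. a i ^ Poly_Mapping.lookup m i))"
  unfolding multipoly_subst_def
  by (rule sum.mono_neutral_left) (use assms in \<open>auto simp: in_keys_iff\<close>)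

lemma multipoly_subst_single:
  fixes h :: "'a::field \<Rightarrow> 'b::field"
  assumes "h 0 = 0"
  shows "multipoly_subst h a (Poly_Mapping.single m c) =
     h c * (\<Prod>i\<in>Poly_Mapping.keys m. a i ^ Poly_Mapping.lookup m i)"
  by (subst multipoly_subst_superset[where A = "{m}"]) (use assms in auto)

lemma multipoly_subst_add:
  fixes h :: "'a::field \<Rightarrow> 'b::field"
  assumes h: "h 0 = 0" "\<And>c d. h (c + d) = h c + h d"
  shows "multipoly_subst h a (p + q) = multipoly_subst h a p + multipoly_subst h a q"
proof -
  let ?A = "Poly_Mapping.keys p \<union> Poly_Mapping.keys q"
  have *: "multipoly_subst h a r =
      (\<Sum>m\<in>?A. h (Poly_Mapping.lookup r m) *
        (\<Prod>i\<in>Poly_Mapping.keys m. a i ^ Poly_Mapping.lookup m i))"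
    if "Poly_Mapping.keys r \<subseteq> ?A" for r
    by (rule multipoly_subst_superset) (use h that in auto)
  show ?thesis
    by (subst (1 2 3) *)
       (use Poly_Mapping.keys_add[of p q] in \<open>auto simp: lookup_add h sum.distrib algebra_simps\<close>)
qed

lemma monomial_subst_add:
  fixes a :: "nat \<Rightarrow> 'b::field"
  shows "(\<Prod>i\<in>Poly_Mapping.keys (m + k). a i ^ Poly_Mapping.lookup (m + k) i) =
     (\<Prod>i\<in>Poly_Mapping.keys m. a i ^ Poly_Mapping.lookup m i) *
     (\<Prod>i\<in>Poly_Mapping.keys k. a i ^ Poly_Mapping.lookup k i)"
proof -
  let ?A = "Poly_Mapping.keys m \<union> Poly_Mapping.keys k"
  have *: "(\<Prod>i\<in>Poly_Mapping.keys l. a i ^ Poly_Mapping.lookup l i) =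
      (\<Prod>i\<in>?A. a i ^ Poly_Mapping.lookup l i)" if "Poly_Mapping.keys l \<subseteq> ?A" for l
    by (rule prod.mono_neutral_left) (use that in \<open>auto simp: in_keys_iff\<close>)
  show ?thesis
    by (subst (1 2 3) *)
       (use Poly_Mapping.keys_add[of m k] in \<open>auto simp: lookup_add power_add prod.distrib\<close>)
qed

lemma multipoly_induct [case_names single sum]:
  fixes p :: "'a::field multipoly"
  assumes single: "\<And>m c. P (Poly_Mapping.single m c)"
    and sum: "\<And>f g. P f \<Longrightarrow> P g \<Longrightarrow> P (f + g)"
  shows "P p"
proof (induction "card (Poly_Mapping.keys p)" arbitrary: p rule: less_induct)
  case less
  show ?case
  proof (cases "p = 0")
    case True
    then show ?thesis using single[of 0 0] by simp
  next
    case False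
    then obtain m where m: "m \<in> Poly_Mapping.keys p" by fastforce
    define f where "f = Poly_Mapping.single m (Poly_Mapping.lookup p m)"
    have "Poly_Mapping.keys (p - f) \<subset> Poly_Mapping.keys p"
      using m by (auto simp: f_def in_keys_iff lookup_minus lookup_single when_def split: if_splits)
    then have "P (p - f)"
      by (intro less) (simp add: psubset_card_mono)
    moreover have "P f"
      unfolding f_def by (rule single)
    ultimately show ?thesis
      using sum[of "p - f" f] by simp
  qed
qed

lemma multipoly_subst_mult:
  fixes h :: "'a::field \<Rightarrow> 'b::field"
  assumes h: "h 0 = 0" "\<And>c d. h (c + d) = h c + h d" "\<And>c d. h (c * d) = h c * h d"
  shows "multipoly_subst h a (p * q) = multipoly_subst h a p * multipoly_subst h a q"
proof -
  have monom: "multipoly_subst h a (Poly_Mapping.single m c * q) =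
      multipoly_subst h a (Poly_Mapping.single m c) * multipoly_subst h a q" for m c
  proof (induction q rule: multipoly_induct)
    case (single k d)
    then show ?case
      by (simp add: mult_single multipoly_subst_single h monomial_subst_add)
  next
    case (sum f g)
    then show ?case
      by (simp add: distrib_left multipoly_subst_add h)
  qed
  show ?thesis
  proof (induction p rule: multipoly_induct)
    case (single k d)
    show ?case by (rule monom)
  next
    case (sum f g)
    then show ?case
      by (simp add: distrib_right multipoly_subst_add h)
  qed
qed

lemma ratfun_subst_Fract:
  fixes h :: "'a::field \<Rightarrow> 'b::field"
  assumes h: "h 0 = 0" "\<And>c d. h (c + d) = h c + h d" "\<And>c d. h (c * d) = h c * h d"
    and q: "multipoly_subst h a q \<noteq> 0"
  shows "ratfun_subst h a (Fract p q) = multipoly_subst h a p / multipoly_subst h a q"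
  unfolding ratfun_subst_def
proof (rule the_equality)
  fix v
  assume "\<exists>p' q'. multipoly_subst h a q' \<noteq> 0 \<and> Fract p q = Fract p' q' \<and>
            v = multipoly_subst h a p' / multipoly_subst h a q'"
  then obtain p' q' where q': "multipoly_subst h a q' \<noteq> 0" and eq: "Fract p q = Fract p' q'"
    and v: "v = multipoly_subst h a p' / multipoly_subst h a q'" by blast
  have "q \<noteq> 0" "q' \<noteq> 0"
    using q q' by (auto simp: multipoly_subst_def)
  then have "p * q' = p' * q"
    using eq by (simp add: eq_fract)
  then have "multipoly_subst h a p * multipoly_subst h a q' =
      multipoly_subst h a p' * multipoly_subst h a q"
    by (metis multipoly_subst_mult[OF h])
  then show "v = multipoly_subst h a p / multipoly_subst h a q"
    using q q' v by (simp add: frac_eq_eq)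
qed (use q in blast)

text \<open>
  The action of \<open>S_n\<close> on functions of the variables, sending the \<open>i\<close>-th variable to the
  \<open>w i\<close>-th one and fixing the coefficients.
\<close>

definition perm_vars :: "(nat \<Rightarrow> nat) \<Rightarrow> 'a::field ratfun \<Rightarrow> 'a ratfun" where
  "perm_vars w = ratfun_subst const (\<lambda>i. indet (w i))"

lemma const_0: "const 0 = 0"
  by (simp add: const_def Zero_fract_def)

lemma const_1: "const 1 = 1"
  by (simp add: const_def One_fract_def)

lemma const_add: "const (c + d) = const c + const d"
  by (simp add: const_def single_add)

lemma const_mult: "const (c * d) = const c * const d"
  by (simp add: const_def mult_single)

lemma perm_vars_const: "perm_vars w (const c) = const c"
proof -
  have "multipoly_subst const (\<lambda>i. indet (w i)) (1 :: 'a multipoly) = 1"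
    using multipoly_subst_single[of const "\<lambda>i. indet (w i)" 0 "1 :: 'a"]
    by (simp add: const_0 const_1)
  then show ?thesis
    unfolding perm_vars_def const_def[of c]
    by (subst ratfun_subst_Fract)
       (simp_all add: const_0 const_add const_mult multipoly_subst_single const_def[symmetric])
qed

lemma perm_vars_indet: "perm_vars w (indet i :: 'a::field ratfun) = indet (w i)"
proof -
  have "multipoly_subst const (\<lambda>i. indet (w i)) (1 :: 'a multipoly) = 1"
    using multipoly_subst_single[of const "\<lambda>i. indet (w i)" 0 "1 :: 'a"]
    by (simp add: const_0 const_1)
  then show ?thesis
    unfolding perm_vars_def indet_def[of i]
    by (subst ratfun_subst_Fract)
       (simp_all add: const_0 const_1 const_add const_mult multipoly_subst_single)
qed

text \<open>
  The exponent of \<open>t^{1/2}\<close> is twice \<open>-(i-1) + (n-1)/2\<close>.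
\<close>

definition ev0 :: "nat \<Rightarrow> coeff_field ratfun \<Rightarrow> coeff_field" where
  "ev0 n = ratfun_subst (\<lambda>c. c) (\<lambda>i. t_half powi (- 2 * (int i - 1) + (int n - 1)))"

section \<open>The c-functions and the generating function\<close>

text \<open>
  The variables \<open>x_i\<close> and \<open>Y_i\<close> live in two separate copies of the same field of rational
  functions, so \<open>indet i\<close> stands for \<open>x_i\<close> in \<open>c_Xinv\<close> and for \<open>Y_i\<close> in \<open>c_Y\<close>.
\<close>

definition c_Xinv :: "nat \<Rightarrow> (nat \<Rightarrow> int) \<Rightarrow> coeff_field ratfun" where
  "c_Xinv n lam =
     (\<Prod>(i, j)\<in>equal_pairs n lam.
        (const (inverse t_half) - const t_half * inverse (indet i) * indet j) /
        (1 - inverse (indet i) * indet j))"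

definition c_Y :: "nat \<Rightarrow> (nat \<Rightarrow> int) \<Rightarrow> coeff_field ratfun" where
  "c_Y n lam =
     (\<Prod>(i, j)\<in>equal_pairs n lam.
        (const (inverse t_half) - const t_half * indet i * inverse (indet j)) /
        (1 - indet i * inverse (indet j)))"

definition stab_poincare :: "nat \<Rightarrow> (nat \<Rightarrow> int) \<Rightarrow> coeff_field" where
  "stab_poincare n lam = (\<Sum>w\<in>stabilizer n lam. t_var ^ perm_length n w)"

definition part_mult :: "nat \<Rightarrow> (nat \<Rightarrow> int) \<Rightarrow> int \<Rightarrow> nat" where
  "part_mult n lam i = card {k\<in>{1..n}. lam k = i}"

definition t_fact :: "nat \<Rightarrow> coeff_field" where
  "t_fact m = (\<Prod>d=1..m. (1 - t_var ^ d) / (1 - t_var))"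

end

theory Submission
  imports Defs
begin

text \<open>
  With \<open>b k = #{i \<le> k. \<lambda>\<^sub>i = \<lambda>\<^sub>k}\<close>, every expression in the theorem equals, up to
  the power of \<open>t^{1/2}\<close>, the product of the \<open>t\<close>-numbers \<open>1 + t + \<dots> + t^{b k - 1}\<close>
  over \<open>k = 1, \<dots>, n\<close>.  The sums over the stabilizer are treated by induction on \<open>n\<close>: the
  cosets of the stabilizer for \<open>n\<close> in the one for \<open>n + 1\<close> are represented by the cycles moving
  \<open>n + 1\<close> to a position \<open>k\<close> of its block.  Such a cycle adds \<open>n + 1 - k\<close> to the length, and for
  the sum of rational functions the induction step is the identity
  \<open>\<Sum>\<^sub>k \<Prod>\<^sub>i\<^sub>\<noteq>\<^sub>k (x\<^sub>i - t x\<^sub>k) / (x\<^sub>i - x\<^sub>k) = 1 + t + \<dots> + t^{m-1}\<close>,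
  which is Lagrange interpolation of \<open>\<Prod>\<^sub>i (x\<^sub>i - t z)\<close> at the nodes \<open>0, x\<^sub>1, \<dots>, x\<^sub>m\<close>, read off
  in degree \<open>m\<close>.
\<close>

section \<open>An interpolation identity\<close>

text \<open>\<open>L\<close> is the Lagrange interpolant of \<open>p\<close> at the nodes in
  \<open>A\<close>. Both polynomials have degree below \<open>card A\<close>, so they coincide. Each
  \<open>l a\<close> is monic of degree \<open>card A - 1\<close>, so the top coefficient of
  \<open>L\<close> is the sum of the weights \<open>c a\<close>.\<close>

lemma sum_lagrange:
  fixes p :: "'a::field poly"
  assumes "finite A" "degree p < card A"
  shows "(\<Sum>a\<in>A. poly p a / (\<Prod>b\<in>A - {a}. a - b)) = coeff p (card A - 1)"
proof -
  define l where "l a = (\<Prod>b\<in>A - {a}. [:- b, 1:])" for a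
  define c where "c a = poly p a / (\<Prod>b\<in>A - {a}. a - b)" for a
  define L where "L = (\<Sum>a\<in>A. smult (c a) (l a))"
  have deg_l: "degree (l a) = card A - 1" if "a \<in> A" for a
    using assms that unfolding l_def by (subst degree_prod_eq_sum_degree) auto
  have "coeff (l a) (degree (l a)) = 1" for a
    unfolding l_def by (simp add: lead_coeff_prod)
  then have coeff_l: "coeff (l a) (card A - 1) = 1" if "a \<in> A" for a
    using deg_l[OF that] by metis
  have "poly L a = poly p a" if "a \<in> A" for a
  proof -
    have "poly L a = (\<Sum>b\<in>A. c b * poly (l b) a)"
      by (simp add: L_def poly_sum)
    also have "\<dots> = (\<Sum>b\<in>A. if b = a then c a * poly (l a) a else 0)"
      using assms that by (intro sum.cong) (auto simp: l_def poly_prod)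
    also have "\<dots> = poly p a"
      using assms that by (auto simp: c_def l_def poly_prod)
    finally show ?thesis .
  qed
  moreover have "degree L < card A"
    using assms deg_l unfolding L_def
    by (intro degree_sum_less) (auto intro: le_less_trans[OF degree_smult_le])
  ultimately have "L = p"
    using assms by (intro poly_eqI_degree[of A]) auto
  moreover have "coeff L (card A - 1) = (\<Sum>a\<in>A. c a)"
    using coeff_l by (simp add: L_def coeff_sum)
  ultimately show ?thesis
    by (simp add: c_def)
qed

text \<open>For \<open>d = 0\<close> the degree may drop, hence a bound on the degree and a separate
  value for the coefficient.\<close>

lemma prod_linear_poly:
  fixes c :: "'b \<Rightarrow> 'a::field"
  assumes "finite B"
  shows "degree (\<Prod>i\<in>B. [:c i, d:]) \<le> card B"
    and "coeff (\<Prod>i\<in>B. [:c i, d:]) (card B) = d ^ card B"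
  using assms
proof (induction B)
  case (insert x F)
  {
    case 1
    have "degree ([:c x, d:] * (\<Prod>i\<in>F. [:c i, d:])) \<le> 1 + card F"
      using insert.IH(1) by (intro order.trans[OF degree_mult_le] add_mono) auto
    then show ?case using insert by simp
  next
    case 2
    have "coeff (\<Prod>i\<in>F. [:c i, d:]) (Suc (card F)) = 0"
      using insert.IH(1) by (intro coeff_eq_0) auto
    then show ?case using insert by simp
  }
qed auto

text \<open>\<open>F\<close> has degree at most \<open>m\<close>, and \<open>0\<close> together with
  \<open>A\<close> gives \<open>m + 1\<close> nodes, so \<open>sum_lagrange\<close> reads off the
  coefficient \<open>(- t) ^ m\<close>. The node \<open>0\<close> contributes
  \<open>(- 1) ^ m\<close>, and the other nodes contribute the sum in question times
  \<open>(- 1) ^ (m - 1) * (1 - t)\<close>, a factor that is cancelled at the end.\<close>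

lemma sum_prod_ratio_set:
  fixes t :: "'a::field"
  assumes "finite A" "0 \<notin> A" "A \<noteq> {}" "t \<noteq> 1"
  shows "(\<Sum>a\<in>A. \<Prod>b\<in>A - {a}. (1 - t * inverse b * a) / (1 - inverse b * a)) = (\<Sum>d<card A. t ^ d)"
proof -
  define F where "F = (\<Prod>b\<in>A. [:b, - t:])"
  define m where "m = card A"
  have poly_F: "poly F z = (\<Prod>b\<in>A. b - t * z)" for z
    by (simp add: F_def poly_prod algebra_simps)
  \<comment> \<open>In \<open>poly F a\<close> the factor of index \<open>a\<close> is
    \<open>(1 - t) * a\<close>, whose \<open>a\<close> cancels against the node \<open>0\<close>.
    Each of the other \<open>m - 1\<close> nodes contributes a sign, since its factor has
    \<open>b - a\<close> in place of \<open>a - b\<close>.\<close>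
  have term_eq: "poly F a / (\<Prod>b\<in>insert 0 A - {a}. a - b) =
      (- 1) ^ (m - 1) * (1 - t) * (\<Prod>b\<in>A - {a}. (1 - t * inverse b * a) / (1 - inverse b * a))"
    if a: "a \<in> A" for a
  proof -
    have "poly F a = (1 - t) * a * (\<Prod>b\<in>A - {a}. b - t * a)"
      using assms a by (simp add: poly_F prod.remove[of A a] algebra_simps)
    moreover have "insert 0 A - {a} = insert 0 (A - {a})"
      using assms a by auto
    then have "(\<Prod>b\<in>insert 0 A - {a}. a - b) = a * (\<Prod>b\<in>A - {a}. a - b)"
      using assms by simp
    moreover have "(\<Prod>b\<in>A - {a}. (1 - t * inverse b * a) / (1 - inverse b * a)) =
        (\<Prod>b\<in>A - {a}. (- 1) * ((b - t * a) / (a - b)))"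
    proof (intro prod.cong refl)
      fix b assume "b \<in> A - {a}"
      then have "b \<noteq> 0" "b - a \<noteq> 0" "a - b \<noteq> 0" using assms by auto
      then show "(1 - t * inverse b * a) / (1 - inverse b * a) = (- 1) * ((b - t * a) / (a - b))"
        by (simp add: field_simps)
    qed
    moreover have "\<dots> = (- 1) ^ (m - 1) * ((\<Prod>b\<in>A - {a}. b - t * a) / (\<Prod>b\<in>A - {a}. a - b))"
      unfolding prod.distrib prod_dividef using assms a by (simp add: m_def)
    moreover have "a \<noteq> 0" using assms a by auto
    moreover have "(- 1 :: 'a) ^ (m - 1) * (- 1) ^ (m - 1) = 1"
      by (simp flip: power_add)
    then have "(- 1) ^ (m - 1) * (1 - t) * ((- 1) ^ (m - 1) * r) = (1 - t) * r" for r
      by (metis mult.assoc mult.commute mult_1)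
    ultimately show ?thesis by simp
  qed
  have "coeff F m = (\<Sum>a\<in>insert 0 A. poly F a / (\<Prod>b\<in>insert 0 A - {a}. a - b))"
    using sum_lagrange[of "insert 0 A" F] prod_linear_poly(1)[of A "\<lambda>b. b" "- t"] assms
    by (simp add: m_def F_def)
  also have "\<dots> = poly F 0 / (\<Prod>b\<in>A. - b) +
      (- 1) ^ (m - 1) * (1 - t) * (\<Sum>a\<in>A. \<Prod>b\<in>A - {a}. (1 - t * inverse b * a) / (1 - inverse b * a))"
    using assms term_eq by (simp add: sum_distrib_left)
  also have "poly F 0 / (\<Prod>b\<in>A. - b) = (\<Prod>b\<in>A. - 1)"
    unfolding poly_F prod_dividef[symmetric] using assms by (intro prod.cong) auto
  also have "\<dots> = (- 1) ^ m"
    by (simp add: m_def)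
  finally have "(- t) ^ m - (- 1) ^ m =
      (- 1) ^ (m - 1) * (1 - t) * (\<Sum>a\<in>A. \<Prod>b\<in>A - {a}. (1 - t * inverse b * a) / (1 - inverse b * a))"
    using prod_linear_poly(2)[of A "\<lambda>b. b" "- t"] assms by (simp add: F_def m_def)
  moreover have "(- t) ^ m - (- 1) ^ m = (- 1) ^ (m - 1) * ((1 - t) * (\<Sum>d<m. t ^ d))"
  proof -
    have "m > 0" using assms by (auto simp: m_def card_gt_0_iff)
    then obtain m' where "m = Suc m'" by (cases m) auto
    then show ?thesis
      unfolding one_diff_power_eq[symmetric] power_minus[of t] by (simp add: algebra_simps)
  qed
  ultimately show ?thesis using assms by (simp add: m_def)
qed

text \<open>Injectivity of \<open>x\<close> makes the nodes distinct, so sums and products over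
  indices become sums and products over the set of nodes.\<close>

lemma sum_prod_ratio:
  fixes x :: "'b \<Rightarrow> 'a::field"
  assumes "finite B" "B \<noteq> {}" "inj_on x B" "\<And>i. i \<in> B \<Longrightarrow> x i \<noteq> 0" "t \<noteq> 1"
  shows "(\<Sum>k\<in>B. \<Prod>i\<in>B - {k}. (1 - t * inverse (x i) * x k) / (1 - inverse (x i) * x k)) =
    (\<Sum>d<card B. t ^ d)"
proof -
  have "(\<Prod>i\<in>B - {k}. (1 - t * inverse (x i) * x k) / (1 - inverse (x i) * x k)) =
      (\<Prod>b\<in>x ` B - {x k}. (1 - t * inverse b * x k) / (1 - inverse b * x k))" if "k \<in> B" for k
  proof -
    have "x ` B - {x k} = x ` (B - {k})"
      using assms that by (auto simp: inj_on_def)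
    then show ?thesis
      using assms by (simp add: prod.reindex inj_on_diff)
  qed
  then show ?thesis
    using sum_prod_ratio_set[of "x ` B" t] assms
    by (force simp: sum.reindex card_image)
qed

section \<open>Stabilizers and lengths\<close>

text \<open>Only positions up to \<open>k\<close> are kept, so the block does not depend on
  \<open>n\<close> and its size is the number \<open>b k\<close> of the overview.\<close>

definition block :: "(nat \<Rightarrow> int) \<Rightarrow> nat \<Rightarrow> nat set" where
  "block lam k = {i\<in>{1..k}. lam i = lam k}"

text \<open>The cycle \<open>(k, k+1, ..., n+1)\<close>: among the permutations of
  \<open>{1..n+1}\<close> sending \<open>n + 1\<close> to \<open>k\<close>, it is the one increasing
  on \<open>{1..n}\<close>, hence the shortest.\<close>

definition cycle_to :: "nat \<Rightarrow> nat \<Rightarrow> nat \<Rightarrow> nat" where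
  "cycle_to n k i = (if i = Suc n then k else if k \<le> i \<and> i \<le> n then Suc i else i)"

lemma finite_block [simp]: "finite (block lam k)"
  by (simp add: block_def)

lemma block_self: "1 \<le> k \<Longrightarrow> k \<in> block lam k"
  by (simp add: block_def)

text \<open>With \<open>a\<close> the least element of the block, monotonicity squeezes
  \<open>lam i\<close> between the equal values \<open>lam a\<close> and
  \<open>lam k\<close>.\<close>

lemma block_eq_interval:
  assumes "antimono_on {1..n} lam" "1 \<le> k" "k \<le> n"
  obtains a where "1 \<le> a" "a \<le> k" "block lam k = {a..k}"
proof -
  define a where "a = Min (block lam k)"
  have ne: "block lam k \<noteq> {}" using block_self assms by blast
  then have a: "a \<in> block lam k" by (simp add: a_def)
  have "block lam k = {a..k}"
  proof (intro equalityI subsetI)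
    fix i assume "i \<in> block lam k"
    then show "i \<in> {a..k}" by (auto simp: a_def block_def)
  next
    fix i assume i: "i \<in> {a..k}"
    have "1 \<le> a" "lam a = lam k" using a by (auto simp: block_def)
    moreover have "lam i \<le> lam a" "lam k \<le> lam i"
      using i \<open>1 \<le> a\<close> assms(3) monotone_onD[OF assms(1), of a i] monotone_onD[OF assms(1), of i k] by auto
    ultimately show "i \<in> block lam k" using i by (auto simp: block_def)
  qed
  with a that show ?thesis by (auto simp: block_def)
qed

text \<open>Grouping the pairs by their larger entry turns products over pairs into products over
  one block at a time, so that passing to \<open>n + 1\<close> adds a single block.\<close>

lemma equal_pairs_eq_image:
  "equal_pairs n lam = (\<lambda>(j, i). (i, j)) ` (SIGMA j:{1..n}. block lam j - {j})"
  by (force simp: equal_pairs_def block_def)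

lemma prod_equal_pairs:
  "(\<Prod>(i, j)\<in>equal_pairs n lam. f i j) = (\<Prod>j=1..n. \<Prod>i\<in>block lam j - {j}. f i j)"
  unfolding equal_pairs_eq_image
  by (subst prod.reindex) (auto simp: inj_on_def prod.Sigma intro!: prod.cong)

lemma card_equal_pairs: "card (equal_pairs n lam) = (\<Sum>j=1..n. card (block lam j) - 1)"
  unfolding equal_pairs_eq_image
  by (subst card_image) (auto simp: inj_on_def card_Diff_singleton block_self intro!: sum.cong)

lemma finite_equal_pairs [simp]: "finite (equal_pairs n lam)"
  unfolding equal_pairs_eq_image by auto

section \<open>The stabilizer and its coset decomposition\<close>

text \<open>Reindexing the positions by \<open>w\<close> removes the inverse in the action on
  positions.\<close>

lemma stabilizer_iff:
  "w \<in> stabilizer n lam \<longleftrightarrow> w permutes {1..n} \<and> (\<forall>i\<in>{1..n}. lam (w i) = lam i)"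
proof -
  have "(\<forall>i\<in>{1..n}. lam (inv w i) = lam i) \<longleftrightarrow> (\<forall>i\<in>{1..n}. lam (w i) = lam i)"
    if w: "w permutes {1..n}"
  proof -
    have "(\<forall>i\<in>w ` {1..n}. lam (inv w i) = lam i) \<longleftrightarrow> (\<forall>i\<in>{1..n}. lam (w i) = lam i)"
      using permutes_inverses(2)[OF w] by auto
    then show ?thesis by (simp only: permutes_image[OF w])
  qed
  then show ?thesis
    by (auto simp: stabilizer_def perm_positions_def)
qed

lemma stabilizer_comp:
  assumes "v \<in> stabilizer n lam" "w \<in> stabilizer n lam"
  shows "v \<circ> w \<in> stabilizer n lam"
  using assms permutes_in_image[of w "{1..n}"]
  by (auto simp: stabilizer_iff permutes_compose)

lemma stabilizer_inv:
  assumes "w \<in> stabilizer n lam"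
  shows "inv w \<in> stabilizer n lam"
proof -
  have w: "w permutes {1..n}" using assms by (simp add: stabilizer_iff)
  have "lam (inv w i) = lam i" if "i \<in> {1..n}" for i
  proof -
    have "inv w i \<in> {1..n}"
      using that permutes_in_image[OF permutes_inv[OF w]] by blast
    then have "lam (w (inv w i)) = lam (inv w i)"
      using assms by (simp add: stabilizer_iff)
    then show ?thesis by (simp add: permutes_inverses(1)[OF w])
  qed
  then show ?thesis
    using permutes_inv[OF w] by (simp add: stabilizer_iff)
qed

text \<open>Permutations are total functions that fix everything outside their set, so the smaller
  stabilizer is literally a subset of the larger one. With the next lemma, it consists of the
  elements fixing \<open>Suc n\<close>.\<close>

lemma stabilizer_Suc_if:
  assumes "w \<in> stabilizer n lam"
  shows "w \<in> stabilizer (Suc n) lam"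
proof -
  have w: "w permutes {1..n}" using assms by (simp add: stabilizer_iff)
  then have "w permutes {1..Suc n}" by (rule permutes_subset) auto
  moreover have "w (Suc n) = Suc n" using w by (rule permutes_not_in) auto
  moreover have "{1..Suc n} = insert (Suc n) {1..n}" by auto
  ultimately show ?thesis using assms by (simp add: stabilizer_iff)
qed

lemma stabilizer_Suc_fixing:
  assumes "w \<in> stabilizer (Suc n) lam" "w (Suc n) = Suc n"
  shows "w \<in> stabilizer n lam"
proof -
  have "w permutes {1..n}"
  proof (rule permutes_superset)
    show "w permutes {1..Suc n}" using assms by (simp add: stabilizer_iff)
    fix i assume "i \<in> {1..Suc n} - {1..n}"
    then have "i = Suc n" by auto
    then show "w i = i" using assms by simp
  qed
  then show ?thesis using assms by (simp add: stabilizer_iff)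
qed

lemma cycle_to_permutes:
  assumes "k \<in> {1..Suc n}"
  shows "cycle_to n k permutes {1..Suc n}"
proof (rule bij_imp_permutes)
  have inj: "inj_on (cycle_to n k) {1..Suc n}"
    using assms by (auto simp: inj_on_def cycle_to_def split: if_splits)
  moreover have "cycle_to n k ` {1..Suc n} \<subseteq> {1..Suc n}"
    using assms by (auto simp: cycle_to_def)
  ultimately show "bij_betw (cycle_to n k) {1..Suc n} {1..Suc n}"
    by (metis bij_betw_def endo_inj_surj finite_atLeastAtMost)
qed (use assms in \<open>auto simp: cycle_to_def\<close>)

text \<open>The cycle moves only positions from \<open>k\<close> to \<open>Suc n\<close>, and these
  all lie in the last block because it is an interval.\<close>

lemma cycle_to_stabilizer:
  assumes "antimono_on {1..Suc n} lam" "k \<in> block lam (Suc n)"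
  shows "cycle_to n k \<in> stabilizer (Suc n) lam"
proof -
  have k: "k \<in> {1..Suc n}" using assms by (auto simp: block_def)
  have eq: "lam i = lam k" if "k \<le> i" "i \<le> Suc n" for i
  proof -
    obtain a where "block lam (Suc n) = {a..Suc n}"
      using block_eq_interval[OF assms(1), of "Suc n"] by auto
    then have "i \<in> block lam (Suc n)"
      using assms(2) that by auto
    then show ?thesis using assms by (auto simp: block_def)
  qed
  have "lam (cycle_to n k i) = lam i" if "i \<in> {1..Suc n}" for i
    using that k eq[of i] eq[of "Suc i"] by (auto simp: cycle_to_def)
  with cycle_to_permutes[OF k] show ?thesis by (simp add: stabilizer_iff)
qed

text \<open>At the last position \<open>n\<close> the block contains every position of
  \<open>{1..n}\<close> with that entry, hence it is invariant.\<close>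

lemma stabilizer_block:
  assumes "w \<in> stabilizer n lam" "1 \<le> n" "i \<in> block lam n"
  shows "w i \<in> block lam n"
  using assms permutes_in_image[of w "{1..n}"]
  by (auto simp: stabilizer_iff block_def)

text \<open>Each \<open>w\<close> factors uniquely as \<open>cycle_to n k \<circ> u\<close> with
  \<open>u\<close> fixing \<open>Suc n\<close>: necessarily \<open>k = w (Suc n)\<close>, which lies
  in the last block, and \<open>u\<close> is then determined.\<close>

lemma sum_stabilizer_Suc:
  assumes "antimono_on {1..Suc n} lam"
  shows "(\<Sum>w\<in>stabilizer (Suc n) lam. f w) =
    (\<Sum>k\<in>block lam (Suc n). \<Sum>u\<in>stabilizer n lam. f (cycle_to n k \<circ> u))"
proof -
  let ?c = "cycle_to n"
  have "(\<Sum>w\<in>stabilizer (Suc n) lam. f w) =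
      (\<Sum>(k, u)\<in>block lam (Suc n) \<times> stabilizer n lam. f (?c k \<circ> u))"
  proof (rule sum.reindex_bij_witness[where
        i = "\<lambda>(k, u). ?c k \<circ> u" and j = "\<lambda>w. (w (Suc n), inv (?c (w (Suc n))) \<circ> w)"])
    fix w assume w: "w \<in> stabilizer (Suc n) lam"
    let ?k = "w (Suc n)"
    have k: "?k \<in> block lam (Suc n)"
      using w by (rule stabilizer_block) (auto simp: block_self)
    note c = cycle_to_stabilizer[OF assms k]
    then have perm: "?c ?k permutes {1..Suc n}" by (simp add: stabilizer_iff)
    have "?c ?k (Suc n) = ?k" by (simp add: cycle_to_def)
    then have "(inv (?c ?k) \<circ> w) (Suc n) = Suc n"
      using permutes_inverses(2)[OF perm] by (metis comp_apply)
    moreover have "inv (?c ?k) \<circ> w \<in> stabilizer (Suc n) lam"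
      using stabilizer_comp[OF stabilizer_inv[OF c] w] .
    ultimately have "inv (?c ?k) \<circ> w \<in> stabilizer n lam"
      by (metis stabilizer_Suc_fixing)
    then show "(?k, inv (?c ?k) \<circ> w) \<in> block lam (Suc n) \<times> stabilizer n lam"
      using k by simp
    show eq: "(case (?k, inv (?c ?k) \<circ> w) of (k, u) \<Rightarrow> ?c k \<circ> u) = w"
      using permutes_inverses(1)[OF perm] by (simp add: fun_eq_iff)
    show "(case (?k, inv (?c ?k) \<circ> w) of (k, u) \<Rightarrow> f (?c k \<circ> u)) = f w"
      using eq by simp
  next
    fix p assume "p \<in> block lam (Suc n) \<times> stabilizer n lam"
    then obtain k u where p: "p = (k, u)" and k: "k \<in> block lam (Suc n)"
      and u: "u \<in> stabilizer n lam" by auto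
    note c = cycle_to_stabilizer[OF assms k]
    then have perm: "?c k permutes {1..Suc n}" by (simp add: stabilizer_iff)
    have "u (Suc n) = Suc n"
      using u by (auto simp: stabilizer_iff intro: permutes_not_in)
    then have "(?c k \<circ> u) (Suc n) = k" by (simp add: cycle_to_def)
    moreover have "inv (?c k) \<circ> (?c k \<circ> u) = u"
      using permutes_inverses(2)[OF perm] by (simp add: fun_eq_iff)
    ultimately show "((case p of (k, u) \<Rightarrow> ?c k \<circ> u) (Suc n),
        inv (?c ((case p of (k, u) \<Rightarrow> ?c k \<circ> u) (Suc n))) \<circ> (case p of (k, u) \<Rightarrow> ?c k \<circ> u)) = p"
      unfolding p prod.case by simp
    show "(case p of (k, u) \<Rightarrow> ?c k \<circ> u) \<in> stabilizer (Suc n) lam"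
      using stabilizer_comp[OF c stabilizer_Suc_if[OF u]] by (simp add: p)
  qed
  then show ?thesis by (simp add: sum.cartesian_product)
qed

section \<open>Inversions and the length generating function\<close>

text \<open>The cycle is increasing on \<open>{1..n}\<close>, so the inversions among the first
  \<open>n\<close> positions are those of \<open>u\<close>. The last position has value
  \<open>k\<close> and is inverted with exactly those \<open>i\<close> for which
  \<open>k \<le> u i\<close>. As \<open>u\<close> permutes \<open>{1..n}\<close>, there are
  \<open>Suc n - k\<close> of them.\<close>

lemma perm_length_cycle_to:
  assumes "k \<in> {1..Suc n}" "u permutes {1..n}"
  shows "perm_length (Suc n) (cycle_to n k \<circ> u) = perm_length n u + (Suc n - k)"
proof -
  let ?w = "cycle_to n k \<circ> u"
  have u_le: "u i \<le> n" if "1 \<le> i" "i \<le> n" for i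
    using that permutes_in_image[OF assms(2)] by (metis atLeastAtMost_iff)
  have u_Suc: "u (Suc n) = Suc n" using assms(2) by (rule permutes_not_in) auto
  have mono: "cycle_to n k i < cycle_to n k j \<longleftrightarrow> i < j" if "i \<le> n" "j \<le> n" for i j
    using that by (auto simp: cycle_to_def)
  have last: "k < cycle_to n k i \<longleftrightarrow> k \<le> i" if "i \<le> n" for i
    using that by (auto simp: cycle_to_def)
  define S where "S = {(i, j). 1 \<le> i \<and> i < j \<and> j \<le> n \<and> u j < u i}"
  define T where "T = {i\<in>{1..n}. k \<le> u i}"
  have inversion: "(1 \<le> i \<and> i < j \<and> j \<le> Suc n \<and> ?w j < ?w i) \<longleftrightarrow> (i, j) \<in> S \<or> (j = Suc n \<and> i \<in> T)" for i j
  proof -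
    consider "j \<le> n" | "j = Suc n" | "j > Suc n" by linarith
    then show ?thesis
    proof cases
      case 1
      then show ?thesis using mono u_le by (auto simp: S_def T_def)
    next
      case 2
      moreover have "cycle_to n k (Suc n) = k" by (simp add: cycle_to_def)
      ultimately show ?thesis using last u_le u_Suc by (auto simp: S_def T_def)
    next
      case 3
      then show ?thesis by (auto simp: S_def)
    qed
  qed
  have "{(i, j). 1 \<le> i \<and> i < j \<and> j \<le> Suc n \<and> ?w j < ?w i} = S \<union> (\<lambda>i. (i, Suc n)) ` T"
    using inversion by (auto simp: image_iff)
  moreover have "finite S"
    by (rule finite_subset[of _ "{1..n} \<times> {1..n}"]) (auto simp: S_def)
  moreover have "S \<inter> (\<lambda>i. (i, Suc n)) ` T = {}"
    by (auto simp: S_def)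
  moreover have "card ((\<lambda>i. (i, Suc n)) ` T) = card T"
    by (rule card_image) (auto simp: inj_on_def)
  moreover have "card T = card (u ` T)"
    using permutes_inj_on[OF assms(2)] by (simp add: card_image)
  moreover have "u ` T = {k..n}"
  proof (intro equalityI subsetI)
    fix j assume j: "j \<in> {k..n}"
    then have "inv u j \<in> {1..n}"
      using assms permutes_in_image[OF permutes_inv[OF assms(2)], of j] by auto
    then show "j \<in> u ` T"
      using j permutes_inverses(1)[OF assms(2)] by (auto simp: T_def intro!: image_eqI[of _ _ "inv u j"])
  qed (use u_le in \<open>auto simp: T_def\<close>)
  moreover have "finite T" by (simp add: T_def)
  ultimately show ?thesis
    by (simp add: perm_length_def S_def card_Un_disjoint)
qed

lemma perm_length_0 [simp]: "perm_length 0 w = 0"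
proof -
  have "{(i, j). 1 \<le> i \<and> i < j \<and> j \<le> (0::nat) \<and> w j < w i} = {}" by auto
  then show ?thesis by (simp only: perm_length_def card.empty)
qed

lemma sum_power_perm_length:
  fixes t :: "'a::comm_semiring_1"
  assumes "antimono_on {1..n} lam"
  shows "(\<Sum>w\<in>stabilizer n lam. t ^ perm_length n w) = (\<Prod>k=1..n. \<Sum>d<card (block lam k). t ^ d)"
  using assms
proof (induction n)
  case 0
  have "stabilizer 0 lam = {id}" by (auto simp: stabilizer_iff)
  then show ?case by simp
next
  case (Suc n)
  have IH: "(\<Sum>w\<in>stabilizer n lam. t ^ perm_length n w) = (\<Prod>k=1..n. \<Sum>d<card (block lam k). t ^ d)"
    using Suc.prems by (intro Suc.IH) (auto intro: monotone_on_subset)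
  obtain a where a: "1 \<le> a" "a \<le> Suc n" and B: "block lam (Suc n) = {a..Suc n}"
    using block_eq_interval[OF Suc.prems, of "Suc n"] by auto
  have "(\<Sum>w\<in>stabilizer (Suc n) lam. t ^ perm_length (Suc n) w) =
      (\<Sum>k\<in>block lam (Suc n). \<Sum>u\<in>stabilizer n lam. t ^ (Suc n - k) * t ^ perm_length n u)"
    unfolding sum_stabilizer_Suc[OF Suc.prems]
  proof (intro sum.cong refl)
    fix k u assume "k \<in> block lam (Suc n)" "u \<in> stabilizer n lam"
    then have "perm_length (Suc n) (cycle_to n k \<circ> u) = perm_length n u + (Suc n - k)"
      by (intro perm_length_cycle_to) (auto simp: block_def stabilizer_iff)
    then show "t ^ perm_length (Suc n) (cycle_to n k \<circ> u) = t ^ (Suc n - k) * t ^ perm_length n u"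
      by (simp add: power_add mult.commute)
  qed
  also have "\<dots> = (\<Sum>k\<in>block lam (Suc n). t ^ (Suc n - k)) * (\<Sum>u\<in>stabilizer n lam. t ^ perm_length n u)"
    by (simp add: sum_product)
  \<comment> \<open>The block is an interval ending at \<open>Suc n\<close>, so the added lengths
    take each value below its size exactly once.\<close>
  also have "(\<Sum>k\<in>block lam (Suc n). t ^ (Suc n - k)) =
      (\<Sum>d<card (block lam (Suc n)). t ^ d)"
    unfolding B
    by (rule sum.reindex_bij_witness[where i = "\<lambda>d. Suc n - d" and j = "\<lambda>k. Suc n - k"])
      (use a in auto)
  finally show ?case
    by (simp add: IH mult.commute)
qed

text \<open>An inversion of a stabilizer element joins positions with equal entries, because
  \<open>lam\<close> is weakly decreasing both at \<open>i, j\<close> and at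
  \<open>w j, w i\<close>. The resulting bound is attained by composing the longest available
  cycles, one for each position.\<close>

lemma perm_length_longest_stab:
  assumes "antimono_on {1..n} lam"
  shows "perm_length n (longest_stab n lam) = card (equal_pairs n lam)"
proof -
  have upper: "perm_length n w \<le> card (equal_pairs n lam)" if w: "w \<in> stabilizer n lam" for w
    unfolding perm_length_def
  proof (rule card_mono)
    show "{(i, j). 1 \<le> i \<and> i < j \<and> j \<le> n \<and> w j < w i} \<subseteq> equal_pairs n lam"
    proof safe
      fix i j assume ij: "1 \<le> i" "i < j" "j \<le> n" "w j < w i"
      then have "i \<in> {1..n}" "j \<in> {1..n}" by auto
      moreover from this w have w_ij: "w i \<in> {1..n}" "w j \<in> {1..n}"
        by (metis stabilizer_iff permutes_in_image)+
      ultimately have "lam j \<le> lam i" "lam (w i) \<le> lam (w j)"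
        using ij w_ij monotone_onD[OF assms, of i j] monotone_onD[OF assms, of "w j" "w i"] by auto
      moreover have "lam (w i) = lam i" "lam (w j) = lam j"
        using w ij by (auto simp: stabilizer_iff)
      ultimately show "(i, j) \<in> equal_pairs n lam"
        using ij by (auto simp: equal_pairs_def)
    qed
  qed simp
  have "\<exists>w\<in>stabilizer n lam. perm_length n w = card (equal_pairs n lam)"
    using assms
  proof (induction n)
    case 0
    have "id \<in> stabilizer 0 lam" by (simp add: stabilizer_iff)
    then show ?case by (auto simp: card_equal_pairs intro!: bexI[of _ id])
  next
    case (Suc n)
    have "antimono_on {1..n} lam"
      using Suc.prems by (rule monotone_on_subset) auto
    then obtain u where u: "u \<in> stabilizer n lam" "perm_length n u = card (equal_pairs n lam)"
      using Suc.IH by blast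
    \<comment> \<open>The least position of the block gives the longest cycle.\<close>
    obtain k where "k \<le> Suc n" and B: "block lam (Suc n) = {k..Suc n}"
      using block_eq_interval[OF Suc.prems, of "Suc n"] by auto
    then have k: "k \<in> block lam (Suc n)" by simp
    have "cycle_to n k \<circ> u \<in> stabilizer (Suc n) lam"
      using stabilizer_comp[OF cycle_to_stabilizer[OF Suc.prems k] stabilizer_Suc_if[OF u(1)]] .
    moreover have "perm_length (Suc n) (cycle_to n k \<circ> u) = perm_length n u + (Suc n - k)"
      using k u by (intro perm_length_cycle_to) (auto simp: block_def stabilizer_iff)
    moreover have "Suc n - k = card (block lam (Suc n)) - 1"
      by (simp add: B)
    moreover have "card (equal_pairs (Suc n) lam) =
        card (equal_pairs n lam) + (card (block lam (Suc n)) - 1)"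
      by (simp add: card_equal_pairs)
    ultimately show ?case using u(2) by (metis (lifting))
  qed
  then obtain w where "w \<in> stabilizer n lam" "perm_length n w = card (equal_pairs n lam)" by blast
  \<comment> \<open>The bounded and attained length is what gives the \<open>ARG_MAX\<close> choice
    its meaning.\<close>
  then show ?thesis
    unfolding longest_stab_def using upper by
    (metis (no_types, lifting) arg_max_nat_le arg_max_natI le_antisym less_Suc_eq_le)
qed

section \<open>The sum of rational functions over the stabilizer\<close>

text \<open>The points \<open>x\<close> are arbitrary, not just the indeterminates, because the
  induction step replaces \<open>x\<close> by \<open>x \<circ> cycle_to n k\<close>.\<close>

lemma sum_stabilizer_prod:
  fixes x :: "nat \<Rightarrow> 'a::field"
  assumes "antimono_on {1..n} lam" "inj_on x {1..n}" "\<And>i. i \<in> {1..n} \<Longrightarrow> x i \<noteq> 0" "t \<noteq> 1"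
  shows "(\<Sum>w\<in>stabilizer n lam. \<Prod>(i, j)\<in>equal_pairs n lam.
      (1 - t * inverse (x (w i)) * x (w j)) / (1 - inverse (x (w i)) * x (w j))) =
    (\<Prod>k=1..n. \<Sum>d<card (block lam k). t ^ d)"
  using assms(1-3)
proof (induction n arbitrary: x)
  case 0
  have "stabilizer 0 lam = {id}" by (auto simp: stabilizer_iff)
  then show ?case by (simp add: prod_equal_pairs)
next
  case (Suc n)
  define r where "r x i j = (1 - t * inverse (x i) * x j) / (1 - inverse (x i) * x j)"
    for x :: "nat \<Rightarrow> 'a" and i j :: nat
  define P where "P x n = (\<Prod>(i, j)\<in>equal_pairs n lam. r x i j)" for x n
  define B where "B = block lam (Suc n)"
  have mono: "antimono_on {1..n} lam"
    using Suc.prems(1) by (rule monotone_on_subset) auto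
  have P_Suc: "P x (Suc n) = P x n * (\<Prod>i\<in>B - {Suc n}. r x i (Suc n))" for x
    by (simp add: P_def B_def prod_equal_pairs)
  \<comment> \<open>On one coset the factors of the pairs ending at \<open>Suc n\<close> have a
    constant product, which leaves the sum of the induction hypothesis at the points
    \<open>x \<circ> cycle_to n k\<close>.\<close>
  have coset: "(\<Sum>u\<in>stabilizer n lam. P (x \<circ> (cycle_to n k \<circ> u)) (Suc n)) =
      (\<Prod>i\<in>B - {k}. r x i k) * (\<Prod>k=1..n. \<Sum>d<card (block lam k). t ^ d)"
    if k: "k \<in> B" for k
  proof -
    let ?c = "cycle_to n k"
    have c: "?c \<in> stabilizer (Suc n) lam"
      using k Suc.prems(1) by (simp add: B_def cycle_to_stabilizer)
    then have perm: "?c permutes {1..Suc n}" by (simp add: stabilizer_iff)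
    have "inj_on (x \<circ> ?c) {1..Suc n}"
      using Suc.prems(2) permutes_inj_on[OF perm] permutes_image[OF perm] by (metis comp_inj_on)
    then have inj: "inj_on (x \<circ> ?c) {1..n}"
      by (rule inj_on_subset) auto
    have nz: "(x \<circ> ?c) i \<noteq> 0" if "i \<in> {1..n}" for i
      using Suc.prems(3)[of "?c i"] permutes_in_image[OF perm, of i] that by auto
    \<comment> \<open>The composite permutes \<open>B\<close> and sends \<open>Suc n\<close> to
      \<open>k\<close>, so it only reorders the factors indexed by \<open>B - {k}\<close>.\<close>
    have last: "(\<Prod>i\<in>B - {Suc n}. r (x \<circ> (?c \<circ> u)) i (Suc n)) = (\<Prod>i\<in>B - {k}. r x i k)"
      if u: "u \<in> stabilizer n lam" for u
    proof -
      have w: "?c \<circ> u \<in> stabilizer (Suc n) lam"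
        using stabilizer_comp[OF c stabilizer_Suc_if[OF u]] .
      then have w_perm: "(?c \<circ> u) permutes {1..Suc n}" by (simp add: stabilizer_iff)
      have "u (Suc n) = Suc n"
        using u by (intro permutes_not_in[of u "{1..n}"]) (auto simp: stabilizer_iff)
      then have w_Suc: "(?c \<circ> u) (Suc n) = k" by (simp add: cycle_to_def)
      have "(?c \<circ> u) ` B \<subseteq> B"
        using stabilizer_block[OF w] unfolding B_def by (intro image_subsetI) simp_all
      then have "(?c \<circ> u) ` B = B"
        using permutes_inj_on[OF w_perm] by (intro endo_inj_surj) (auto simp: B_def)
      then have "(?c \<circ> u) ` (B - {Suc n}) = B - {k}"
        using w_Suc image_set_diff[OF permutes_inj[OF w_perm], of B "{Suc n}"]
        by (simp only: image_insert image_empty)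
      then have bij: "bij_betw (?c \<circ> u) (B - {Suc n}) (B - {k})"
        using permutes_inj_on[OF w_perm] by (simp only: bij_betw_def)
      have "(\<Prod>i\<in>B - {Suc n}. r (x \<circ> (?c \<circ> u)) i (Suc n)) = (\<Prod>i\<in>B - {Suc n}. r x ((?c \<circ> u) i) k)"
        using w_Suc by (simp add: r_def)
      also have "\<dots> = (\<Prod>i\<in>B - {k}. r x i k)"
        by (rule prod.reindex_bij_betw[OF bij])
      finally show ?thesis .
    qed
    have "(\<Sum>u\<in>stabilizer n lam. P (x \<circ> (?c \<circ> u)) (Suc n)) =
        (\<Sum>u\<in>stabilizer n lam. P (x \<circ> ?c \<circ> u) n * (\<Prod>i\<in>B - {k}. r x i k))"
      using last by (intro sum.cong) (auto simp: P_Suc comp_assoc)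
    also have "\<dots> = (\<Prod>i\<in>B - {k}. r x i k) * (\<Sum>u\<in>stabilizer n lam. P (x \<circ> ?c \<circ> u) n)"
      by (simp add: sum_distrib_left mult.commute)
    also have "(\<Sum>u\<in>stabilizer n lam. P (x \<circ> ?c \<circ> u) n) = (\<Prod>k=1..n. \<Sum>d<card (block lam k). t ^ d)"
      using Suc.IH[OF mono inj nz] by (simp add: P_def r_def)
    finally show ?thesis .
  qed
  have "B \<subseteq> {1..Suc n}" by (auto simp: B_def block_def)
  \<comment> \<open>The coset constants add up by the interpolation identity at the points of the
    last block.\<close>
  then have "(\<Sum>k\<in>B. \<Prod>i\<in>B - {k}. r x i k) = (\<Sum>d<card B. t ^ d)"
    unfolding r_def using Suc.prems \<open>t \<noteq> 1\<close> block_self[of "Suc n" lam]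
    by (intro sum_prod_ratio) (auto simp: B_def intro: inj_on_subset)
  then have "(\<Sum>w\<in>stabilizer (Suc n) lam. P (x \<circ> w) (Suc n)) =
      (\<Sum>d<card B. t ^ d) * (\<Prod>k=1..n. \<Sum>d<card (block lam k). t ^ d)"
    unfolding sum_stabilizer_Suc[OF Suc.prems(1)] B_def[symmetric]
    by (simp add: coset flip: sum_distrib_right)
  then show ?case
    by (simp add: P_def r_def B_def mult.commute)
qed

section \<open>The product over pairs of equal entries\<close>

lemma prod_telescope_power:
  fixes t :: "'a::field"
  assumes "\<And>d. 0 < d \<Longrightarrow> t ^ d \<noteq> 1"
  shows "(\<Prod>d=1..m. (1 - t ^ (d + 1)) / (1 - t ^ d)) = (\<Sum>d<Suc m. t ^ d)"
proof -
  have nz: "1 - t ^ d \<noteq> 0" if "0 < d" for d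
    using assms[OF that] by simp
  have "(\<Prod>d=1..m. (1 - t ^ (d + 1)) / (1 - t ^ d)) = (1 - t ^ Suc m) / (1 - t)"
  proof (induction m)
    case 0
    then show ?case using nz[of 1] by simp
  next
    case (Suc m)
    then show ?case using nz[of "Suc m"] by (simp del: power_Suc)
  qed
  then show ?thesis
    using nz[of 1] by (simp only: one_diff_power_eq) simp
qed

text \<open>For a fixed larger index \<open>k\<close> with block \<open>{a..k}\<close>, the
  differences \<open>k - i\<close> run through \<open>1, ..., k - a\<close>, so the factors
  telescope to the \<open>t\<close>-number of the block size \<open>k - a + 1\<close>.\<close>

lemma prod_equal_pairs_power:
  fixes t :: "'a::field"
  assumes "antimono_on {1..n} lam" "\<And>d. 0 < d \<Longrightarrow> t ^ d \<noteq> 1"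
  shows "(\<Prod>(i, j)\<in>equal_pairs n lam. (1 - t ^ (j - i + 1)) / (1 - t ^ (j - i))) =
    (\<Prod>k=1..n. \<Sum>d<card (block lam k). t ^ d)"
  unfolding prod_equal_pairs
proof (intro prod.cong refl)
  fix k assume "k \<in> {1..n}"
  then obtain a where a: "1 \<le> a" "a \<le> k" and B: "block lam k = {a..k}"
    using block_eq_interval[OF assms(1), of k] by auto
  have "(\<Prod>i\<in>block lam k - {k}. (1 - t ^ (k - i + 1)) / (1 - t ^ (k - i))) =
      (\<Prod>d=1..k - a. (1 - t ^ (d + 1)) / (1 - t ^ d))"
    unfolding B
    by (rule prod.reindex_bij_witness[where i = "\<lambda>d. k - d" and j = "\<lambda>i. k - i"]) (use a in auto)
  also have "\<dots> = (\<Sum>d<Suc (k - a). t ^ d)"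
    using assms(2) by (rule prod_telescope_power)
  also have "Suc (k - a) = card (block lam k)"
    using a by (simp add: B)
  finally show "(\<Prod>i\<in>block lam k - {k}. (1 - t ^ (k - i + 1)) / (1 - t ^ (k - i))) =
    (\<Sum>d<card (block lam k). t ^ d)" .
qed

section \<open>The parameter \<open>t\<close> and the \<open>t\<close>-factorials\<close>

lemma t_half_power: "t_half ^ k = Fract (monom 1 k) 1"
  by (induction k) (simp_all add: t_half_def One_fract_def monom_Suc)

lemma t_half_nonzero [simp]: "t_half \<noteq> 0"
  by (simp add: t_half_def Zero_fract_def eq_fract)

text \<open>As a polynomial in \<open>t_half\<close>, the power has degree \<open>2 * d > 0\<close>.
  This keeps all denominators \<open>1 - t ^ d\<close> nonzero.\<close>

lemma t_var_power_neq_1: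
  assumes "0 < d"
  shows "t_var ^ d \<noteq> 1"
proof -
  have "monom (1 :: complex) (2 * d) \<noteq> 1"
    using assms by (metis degree_1 degree_monom_eq less_numeral_extra(3) mult_pos_pos zero_less_numeral zero_neq_one)
  moreover have "t_var ^ d = Fract (monom 1 (2 * d)) 1"
    unfolding t_var_def power_mult[symmetric] by (rule t_half_power)
  ultimately show ?thesis
    by (simp add: One_fract_def eq_fract)
qed

lemma t_fact_0 [simp]: "t_fact 0 = 1"
  by (simp add: t_fact_def)

lemma t_fact_Suc: "t_fact (Suc m) = t_fact m * (\<Sum>d<Suc m. t_var ^ d)"
  using t_var_power_neq_1[of 1] one_diff_power_eq[of t_var "Suc m"]
  by (simp add: t_fact_def del: power_Suc sum.lessThan_Suc)

text \<open>Passing to \<open>Suc n\<close> raises only the multiplicity of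
  \<open>lam (Suc n)\<close>. The new multiplicity is the size of the new block, and its
  \<open>t\<close>-number is the ratio of the two \<open>t\<close>-factorials.\<close>

lemma prod_t_fact_part_mult:
  "(\<Prod>i. t_fact (part_mult n lam i)) = (\<Prod>k=1..n. \<Sum>d<card (block lam k). t_var ^ d)"
proof (induction n)
  case 0
  then show ?case by (simp add: part_mult_def)
next
  case (Suc n)
  define c where "c = lam (Suc n)"
  define A where "A = lam ` {1..Suc n}"
  \<comment> \<open>The finite set \<open>A\<close> serves both \<open>n\<close> and
    \<open>Suc n\<close>: outside it the multiplicity is \<open>0\<close>, and
    \<open>t_fact 0 = 1\<close>.\<close>
  have Prod_any_eq: "(\<Prod>i. t_fact (part_mult m lam i)) = (\<Prod>i\<in>A. t_fact (part_mult m lam i))"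
    if "m \<le> Suc n" for m
  proof (rule Prod_any.expand_superset)
    have "i \<in> A" if "t_fact (part_mult m lam i) \<noteq> 1" for i
    proof -
      from that have "{k\<in>{1..m}. lam k = i} \<noteq> {}"
        by (metis card.empty part_mult_def t_fact_0)
      then show ?thesis using \<open>m \<le> Suc n\<close> by (auto simp: A_def)
    qed
    then show "{i. t_fact (part_mult m lam i) \<noteq> 1} \<subseteq> A" by blast
  qed (simp add: A_def)
  have c: "c \<in> A" and fin: "finite A" by (auto simp: A_def c_def)
  have other: "part_mult (Suc n) lam i = part_mult n lam i" if "i \<noteq> c" for i
    using that unfolding part_mult_def c_def
    by (intro arg_cong[of _ _ card]) (auto simp: le_Suc_eq)
  have "{k\<in>{1..Suc n}. lam k = c} = insert (Suc n) {k\<in>{1..n}. lam k = c}"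
    by (auto simp: c_def)
  then have part_c: "part_mult (Suc n) lam c = Suc (part_mult n lam c)"
    by (simp add: part_mult_def)
  have "block lam (Suc n) = {k\<in>{1..Suc n}. lam k = c}"
    by (simp add: block_def c_def)
  then have card_c: "card (block lam (Suc n)) = Suc (part_mult n lam c)"
    using part_c by (simp add: part_mult_def)
  have "(\<Prod>i. t_fact (part_mult (Suc n) lam i)) =
      t_fact (Suc (part_mult n lam c)) * (\<Prod>i\<in>A - {c}. t_fact (part_mult n lam i))"
    by (simp add: Prod_any_eq prod.remove[OF fin c] part_c other)
  also have "\<dots> = (\<Prod>i. t_fact (part_mult n lam i)) * (\<Sum>d<card (block lam (Suc n)). t_var ^ d)"
    by (simp add: Prod_any_eq prod.remove[OF fin c] t_fact_Suc card_c del: sum.lessThan_Suc)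
  finally show ?case
    by (simp add: Suc.IH)
qed

section \<open>Substitution as a partial homomorphism\<close>

text \<open>
  The substitution is only partially defined on fractions, so its multiplicativity and additivity
  are expressed through the graph of the partial map.
\<close>

definition substs_to ::
  "('a::field \<Rightarrow> 'b::field) \<Rightarrow> (nat \<Rightarrow> 'b) \<Rightarrow> 'a ratfun \<Rightarrow> 'b \<Rightarrow> bool" where
  "substs_to h a r v \<longleftrightarrow> (\<exists>p q. multipoly_subst h a q \<noteq> 0 \<and> r = Fract p q \<and>
     v = multipoly_subst h a p / multipoly_subst h a q)"

text \<open>The condition \<open>h 1 = 1\<close> makes \<open>1\<close> an admissible denominator,
  so constants and indeterminates can be substituted into.\<close>

definition field_hom :: "('a::field \<Rightarrow> 'b::field) \<Rightarrow> bool" where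
  "field_hom h \<longleftrightarrow> h 0 = 0 \<and> h 1 = 1 \<and>
     (\<forall>c d. h (c + d) = h c + h d) \<and> (\<forall>c d. h (c * d) = h c * h d)"

lemma field_homD:
  assumes "field_hom h"
  shows "h 0 = 0" "h 1 = 1" "h (c + d) = h c + h d" "h (c * d) = h c * h d"
  using assms by (auto simp: field_hom_def)

lemma field_hom_const: "field_hom const"
  by (simp add: field_hom_def const_0 const_1 const_add const_mult)

lemma field_hom_id: "field_hom (\<lambda>c. c)"
  by (simp add: field_hom_def)

text \<open>The zero polynomial evaluates to an empty sum, so a denominator with nonzero value is
  itself nonzero, as the arithmetic of fractions requires.\<close>

lemma substs_toE:
  assumes "substs_to h a r v"
  obtains p q where "multipoly_subst h a q \<noteq> 0" "q \<noteq> 0" "r = Fract p q"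
    "v = multipoly_subst h a p / multipoly_subst h a q"
proof -
  obtain p q where *: "multipoly_subst h a q \<noteq> 0" "r = Fract p q"
      "v = multipoly_subst h a p / multipoly_subst h a q"
    using assms unfolding substs_to_def by blast
  then have "q \<noteq> 0" by (auto simp: multipoly_subst_def)
  with * that show ?thesis by blast
qed

lemma ratfun_subst_eq:
  assumes "field_hom h" "substs_to h a r v"
  shows "ratfun_subst h a r = v"
proof -
  obtain p q where "multipoly_subst h a q \<noteq> 0" "r = Fract p q"
      "v = multipoly_subst h a p / multipoly_subst h a q"
    using assms(2) by (blast elim: substs_toE)
  then show ?thesis
    using assms(1) by (simp add: ratfun_subst_Fract field_homD)
qed

lemma multipoly_subst_1: "field_hom h \<Longrightarrow> multipoly_subst h a 1 = 1"
  using multipoly_subst_single[of h a 0 1] by (simp add: field_homD)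

lemma multipoly_subst_diff:
  assumes "field_hom h"
  shows "multipoly_subst h a (p - q) = multipoly_subst h a p - multipoly_subst h a q"
  using multipoly_subst_add[of h a "p - q" q] by (simp add: field_homD[OF assms])

lemma substs_to_const: "field_hom h \<Longrightarrow> substs_to h a (const c) (h c)"
  unfolding substs_to_def const_def
  by (intro exI[of _ "Poly_Mapping.single 0 c"] exI[of _ 1])
     (simp add: multipoly_subst_single multipoly_subst_1 field_homD)

lemma substs_to_1: "field_hom h \<Longrightarrow> substs_to h a 1 1"
  using substs_to_const[of h a 1] by (simp add: const_1 field_homD)

lemma substs_to_indet: "field_hom h \<Longrightarrow> substs_to h a (indet i) (a i)"
  unfolding substs_to_def indet_def
  by (intro exI[of _ "Poly_Mapping.single (Poly_Mapping.single i 1) 1"] exI[of _ 1])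
     (simp add: multipoly_subst_single multipoly_subst_1 field_homD)

lemma substs_to_mult:
  assumes "field_hom h" "substs_to h a r v" "substs_to h a s w"
  shows "substs_to h a (r * s) (v * w)"
proof -
  obtain p q where "multipoly_subst h a q \<noteq> 0" "r = Fract p q"
      "v = multipoly_subst h a p / multipoly_subst h a q"
    using assms(2) by (blast elim: substs_toE)
  moreover obtain p' q' where "multipoly_subst h a q' \<noteq> 0" "s = Fract p' q'"
      "w = multipoly_subst h a p' / multipoly_subst h a q'"
    using assms(3) by (blast elim: substs_toE)
  ultimately show ?thesis
    unfolding substs_to_def
    by (intro exI[of _ "p * p'"] exI[of _ "q * q'"])
       (simp add: multipoly_subst_mult field_homD[OF assms(1)])
qed

lemma substs_to_diff:
  assumes "field_hom h" "substs_to h a r v" "substs_to h a s w"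
  shows "substs_to h a (r - s) (v - w)"
proof -
  obtain p q where "multipoly_subst h a q \<noteq> 0" "q \<noteq> 0" "r = Fract p q"
      "v = multipoly_subst h a p / multipoly_subst h a q"
    using assms(2) by (blast elim: substs_toE)
  moreover obtain p' q' where "multipoly_subst h a q' \<noteq> 0" "q' \<noteq> 0" "s = Fract p' q'"
      "w = multipoly_subst h a p' / multipoly_subst h a q'"
    using assms(3) by (blast elim: substs_toE)
  ultimately show ?thesis
    unfolding substs_to_def
    by (intro exI[of _ "p * q' - p' * q"] exI[of _ "q * q'"])
       (simp add: multipoly_subst_mult multipoly_subst_diff[OF assms(1)] field_homD[OF assms(1)]
          diff_frac_eq)
qed

text \<open>Since \<open>v\<close> is nonzero, so is the value of the numerator, which may then
  serve as denominator.\<close>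

lemma substs_to_inverse:
  assumes "substs_to h a r v" "v \<noteq> 0"
  shows "substs_to h a (inverse r) (inverse v)"
proof -
  obtain p q where "multipoly_subst h a q \<noteq> 0" "r = Fract p q"
      "v = multipoly_subst h a p / multipoly_subst h a q"
    using assms(1) by (blast elim: substs_toE)
  then show ?thesis
    unfolding substs_to_def using assms(2)
    by (intro exI[of _ q] exI[of _ p]) auto
qed

lemma substs_to_divide:
  assumes "field_hom h" "substs_to h a r v" "substs_to h a s w" "w \<noteq> 0"
  shows "substs_to h a (r / s) (v / w)"
  using substs_to_mult[OF assms(1,2) substs_to_inverse[OF assms(3,4)]]
  by (simp add: divide_inverse)

lemma substs_to_prod:
  assumes "field_hom h" "\<And>i. i \<in> A \<Longrightarrow> substs_to h a (f i) (g i)"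
  shows "substs_to h a (\<Prod>i\<in>A. f i) (\<Prod>i\<in>A. g i)"
  using assms(2)
  by (induction A rule: infinite_finite_induct)
     (auto intro: substs_to_1[OF assms(1)] substs_to_mult[OF assms(1)])

section \<open>Constants and indeterminates in the field of rational functions\<close>

lemma const_sum: "const (sum f A) = (\<Sum>i\<in>A. const (f i))"
  by (induction A rule: infinite_finite_induct) (auto simp: const_0 const_add)

lemma const_prod: "const (prod f A) = (\<Prod>i\<in>A. const (f i))"
  by (induction A rule: infinite_finite_induct) (auto simp: const_1 const_mult)

lemma const_power: "const (c ^ k) = const c ^ k"
  by (induction k) (auto simp: const_1 const_mult)

lemma single_inject:
  assumes "Poly_Mapping.single a c = Poly_Mapping.single b d" "c \<noteq> 0"
  shows "a = b \<and> c = d"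
  using assms by (metis lookup_single_eq lookup_single_not_eq)

lemma const_eq_iff [simp]: "const c = const d \<longleftrightarrow> c = d"
proof
  assume "const c = const d"
  then have "Poly_Mapping.single (0 :: nat \<Rightarrow>\<^sub>0 nat) c = Poly_Mapping.single 0 d"
    by (simp add: const_def eq_fract)
  then show "c = d" by (metis lookup_single_eq)
qed simp

lemma indet_nonzero [simp]: "indet i \<noteq> (0 :: 'a::field ratfun)"
proof -
  have "Poly_Mapping.single (Poly_Mapping.single i (1::nat)) (1::'a) \<noteq> 0"
    by (metis lookup_single_eq lookup_zero zero_neq_one)
  then show ?thesis
    by (simp add: indet_def Zero_fract_def eq_fract)
qed

lemma indet_eq_iff [simp]: "indet i = (indet j :: 'a::field ratfun) \<longleftrightarrow> i = j"
proof
  assume "indet i = (indet j :: 'a ratfun)"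
  then have "Poly_Mapping.single (Poly_Mapping.single i (Suc 0)) (1::'a) =
      Poly_Mapping.single (Poly_Mapping.single j (Suc 0)) 1"
    by (simp add: indet_def eq_fract)
  then show "i = j"
    by (auto dest!: single_inject)
qed simp

section \<open>Permuting the variables and evaluating the c-functions\<close>

text \<open>The choice \<open>c = inverse t_half\<close>, \<open>d = t_half\<close> gives
  \<open>c_Xinv\<close>, and \<open>c = 1\<close>, \<open>d = t_var\<close> gives the product in the
  alternative form. Injectivity of \<open>w\<close> keeps the substituted denominators
  nonzero.\<close>

lemma perm_vars_prod_equal_pairs:
  fixes c d :: "'a::field"
  assumes "w permutes {1..n}"
  shows "perm_vars w (\<Prod>(i, j)\<in>equal_pairs n lam.
      (const c - const d * inverse (indet i) * indet j) / (1 - inverse (indet i) * indet j)) =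
    (\<Prod>(i, j)\<in>equal_pairs n lam.
      (const c - const d * inverse (indet (w i)) * indet (w j)) /
      (1 - inverse (indet (w i)) * indet (w j)))"
  unfolding perm_vars_def
proof (rule ratfun_subst_eq[OF field_hom_const], rule substs_to_prod[OF field_hom_const], clarify)
  fix i j assume "(i, j) \<in> equal_pairs n lam"
  then have "w i \<noteq> w j"
    using permutes_inj[OF assms] by (auto simp: equal_pairs_def inj_eq)
  then have "1 - inverse (indet (w i)) * indet (w j) \<noteq> (0 :: 'a ratfun)"
    by (simp add: field_simps)
  then show "substs_to const (\<lambda>i. indet (w i))
      ((const c - const d * inverse (indet i) * indet j) / (1 - inverse (indet i) * indet j))
      ((const c - const d * inverse (indet (w i)) * indet (w j)) /
        (1 - inverse (indet (w i)) * indet (w j)))"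
    by (intro substs_to_divide[OF field_hom_const] substs_to_diff[OF field_hom_const]
        substs_to_mult[OF field_hom_const]
        substs_to_inverse substs_to_const[OF field_hom_const] substs_to_1[OF field_hom_const]
        substs_to_indet[OF field_hom_const, of "\<lambda>i. indet (w i)"]) auto
qed

text \<open>The evaluation sends the quotient of the variables \<open>i\<close> and \<open>j\<close>
  to \<open>t_var ^ (j - i)\<close>, which is not \<open>1\<close>, and every factor splits off one
  \<open>inverse t_half\<close>.\<close>

lemma ev0_c_Y:
  "ev0 n (c_Y n lam) = inverse t_half ^ card (equal_pairs n lam) *
     (\<Prod>(i, j)\<in>equal_pairs n lam. (1 - t_var ^ (j - i + 1)) / (1 - t_var ^ (j - i)))"
proof -
  define a where "a i = t_half powi (- 2 * (int i - 1) + (int n - 1))" for i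
  have a_nz: "a i \<noteq> 0" for i
    by (simp add: a_def)
  \<comment> \<open>The common shift \<open>n - 1\<close> cancels, leaving the exponent
    \<open>2 * (j - i)\<close> of \<open>t_half\<close>.\<close>
  have ratio: "a i * inverse (a j) = t_var ^ (j - i)" if "i < j" for i j
  proof -
    have "a i * inverse (a j) = t_half powi (int (2 * (j - i)))"
      using that by (simp add: a_def of_nat_diff flip: power_int_minus power_int_add)
    then show ?thesis
      by (simp only: power_int_of_nat power_mult t_var_def)
  qed
  have "ev0 n (c_Y n lam) = (\<Prod>(i, j)\<in>equal_pairs n lam.
      (inverse t_half - t_half * a i * inverse (a j)) / (1 - a i * inverse (a j)))"
    unfolding ev0_def c_Y_def a_def[symmetric]
  proof (rule ratfun_subst_eq[OF field_hom_id], rule substs_to_prod[OF field_hom_id], clarify)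
    fix i j assume "(i, j) \<in> equal_pairs n lam"
    then have "i < j" by (simp add: equal_pairs_def)
    then have "1 - a i * inverse (a j) \<noteq> 0"
      using t_var_power_neq_1[of "j - i"] by (simp add: ratio)
    then show "substs_to (\<lambda>c. c) a
        ((const (inverse t_half) - const t_half * indet i * inverse (indet j)) /
          (1 - indet i * inverse (indet j)))
        ((inverse t_half - t_half * a i * inverse (a j)) / (1 - a i * inverse (a j)))"
      by (intro substs_to_divide[OF field_hom_id] substs_to_diff[OF field_hom_id]
          substs_to_mult[OF field_hom_id]
          substs_to_inverse substs_to_const[OF field_hom_id] substs_to_1[OF field_hom_id]
          substs_to_indet[OF field_hom_id] a_nz)
  qed
  also have "\<dots> = (\<Prod>(i, j)\<in>equal_pairs n lam.
      inverse t_half * ((1 - t_var ^ (j - i + 1)) / (1 - t_var ^ (j - i))))"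
  proof (intro prod.cong refl, clarify)
    fix i j assume "(i, j) \<in> equal_pairs n lam"
    then have "i < j" by (simp add: equal_pairs_def)
    have "inverse t_half - t_half * a i * inverse (a j) =
        inverse t_half * (1 - t_var ^ (j - i + 1))"
      by (simp add: mult.assoc ratio[OF \<open>i < j\<close>] algebra_simps)
        (simp add: t_var_def power2_eq_square)
    then show "(inverse t_half - t_half * a i * inverse (a j)) / (1 - a i * inverse (a j)) =
        inverse t_half * ((1 - t_var ^ (j - i + 1)) / (1 - t_var ^ (j - i)))"
      by (simp add: ratio[OF \<open>i < j\<close>])
  qed
  also have "\<dots> = inverse t_half ^ card (equal_pairs n lam) *
     (\<Prod>(i, j)\<in>equal_pairs n lam. (1 - t_var ^ (j - i + 1)) / (1 - t_var ^ (j - i)))"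
    by (simp only: case_prod_unfold prod.distrib prod_constant)
  finally show ?thesis .
qed

text \<open>As \<open>t_half = inverse t_half * t_var\<close>, each factor releases the same
  constant. At \<open>x i = indet (w i)\<close> the prefactor is independent of \<open>w\<close>, so
  it comes out of the sum over the stabilizer.\<close>

lemma prod_equal_pairs_factor:
  fixes x :: "nat \<Rightarrow> coeff_field ratfun"
  shows "(\<Prod>(i, j)\<in>equal_pairs n lam.
       (const (inverse t_half) - const t_half * inverse (x i) * x j) / (1 - inverse (x i) * x j)) =
     const (inverse t_half ^ card (equal_pairs n lam)) *
     (\<Prod>(i, j)\<in>equal_pairs n lam.
        (1 - const t_var * inverse (x i) * x j) / (1 - inverse (x i) * x j))"
proof -
  have "const (inverse t_half) * const t_var = const t_half"
    by (simp add: t_var_def power2_eq_square flip: const_mult)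
  then have "const (inverse t_half) - const t_half * y * z =
      const (inverse t_half) * (1 - const t_var * y * z)" for y z
    by (simp add: right_diff_distrib flip: mult.assoc)
  then have "(\<Prod>(i, j)\<in>equal_pairs n lam.
       (const (inverse t_half) - const t_half * inverse (x i) * x j) / (1 - inverse (x i) * x j)) =
     (\<Prod>(i, j)\<in>equal_pairs n lam. const (inverse t_half) *
        ((1 - const t_var * inverse (x i) * x j) / (1 - inverse (x i) * x j)))"
    by simp
  then show ?thesis
    by (simp only: case_prod_unfold prod.distrib prod_constant const_power)
qed

theorem proposition4p6:
  fixes n :: nat and lam :: "nat \<Rightarrow> int"
  assumes "1 \<le> n"
    and "\<And>i j. 1 \<le> i \<Longrightarrow> i \<le> j \<Longrightarrow> j \<le> n \<Longrightarrow> lam j \<le> lam i"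
  shows "(t_half powi (- int (perm_length n (longest_stab n lam))) * stab_poincare n lam
            = ev0 n (c_Y n lam))
    \<and> (const (ev0 n (c_Y n lam)) = (\<Sum>w\<in>stabilizer n lam. perm_vars w (c_Xinv n lam)))
    \<and> (const (stab_poincare n lam)
           = (\<Sum>w\<in>stabilizer n lam. perm_vars w
                (\<Prod>(i, j)\<in>equal_pairs n lam.
                   (1 - const t_var * inverse (indet i) * indet j) /
                   (1 - inverse (indet i) * indet j))))
    \<and> (stab_poincare n lam
           = (\<Prod>(i, j)\<in>equal_pairs n lam. (1 - t_var ^ (j - i + 1)) / (1 - t_var ^ (j - i))))
    \<and> ((\<Prod>(i, j)\<in>equal_pairs n lam. (1 - t_var ^ (j - i + 1)) / (1 - t_var ^ (j - i)))
           = (\<Prod>i. t_fact (part_mult n lam i)))"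
proof -
  define N where "N = card (equal_pairs n lam)"
  \<comment> \<open>\<open>F\<close> is the common value of the expressions in the alternative form.
    Those in the first chain equal \<open>inverse t_half ^ N * F\<close>.\<close>
  define F where "F = (\<Prod>k=1..n. \<Sum>d<card (block lam k). t_var ^ d)"
  define R :: "coeff_field ratfun" where
    "R = (\<Prod>(i, j)\<in>equal_pairs n lam.
       (1 - const t_var * inverse (indet i) * indet j) / (1 - inverse (indet i) * indet j))"
  have mono: "antimono_on {1..n} lam"
    using assms(2) by (auto intro: monotone_onI)
  have poincare: "stab_poincare n lam = F"
    unfolding stab_poincare_def F_def by (rule sum_power_perm_length[OF mono])
  have pairs: "(\<Prod>(i, j)\<in>equal_pairs n lam. (1 - t_var ^ (j - i + 1)) / (1 - t_var ^ (j - i))) = F"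
    unfolding F_def by (rule prod_equal_pairs_power[OF mono t_var_power_neq_1])
  have ev: "ev0 n (c_Y n lam) = inverse t_half ^ N * F"
    by (simp only: ev0_c_Y pairs N_def)
  have longest: "t_half powi (- int (perm_length n (longest_stab n lam))) = inverse t_half ^ N"
    by (simp add: perm_length_longest_stab[OF mono] N_def power_int_minus power_inverse)
  have t1: "const t_var \<noteq> (1 :: coeff_field ratfun)"
    using t_var_power_neq_1[of 1] by (simp flip: const_1)
  have "(\<Sum>w\<in>stabilizer n lam. perm_vars w R) =
      (\<Sum>w\<in>stabilizer n lam. \<Prod>(i, j)\<in>equal_pairs n lam.
        (1 - const t_var * inverse (indet (w i)) * indet (w j)) /
        (1 - inverse (indet (w i)) * indet (w j)))"
  proof (intro sum.cong refl)
    fix w assume "w \<in> stabilizer n lam"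
    then show "perm_vars w R = (\<Prod>(i, j)\<in>equal_pairs n lam.
        (1 - const t_var * inverse (indet (w i)) * indet (w j)) /
        (1 - inverse (indet (w i)) * indet (w j)))"
      using perm_vars_prod_equal_pairs[where w = w and n = n and lam = lam and c = 1 and d = t_var]
      by (simp add: stabilizer_iff R_def const_1)
  qed
  \<comment> \<open>The indeterminates are distinct and nonzero, so they are admissible points over
    the field of rational functions itself.\<close>
  also have "\<dots> = (\<Prod>k=1..n. \<Sum>d<card (block lam k). const t_var ^ d)"
    using mono t1 by (intro sum_stabilizer_prod) (auto simp: inj_on_def)
  also have "\<dots> = const F"
    by (simp add: F_def const_prod const_sum const_power)
  finally have sum_R: "(\<Sum>w\<in>stabilizer n lam. perm_vars w R) = const F" .
  have "perm_vars w (c_Xinv n lam) = const (inverse t_half ^ N) * perm_vars w R"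
    if w: "w \<in> stabilizer n lam" for w
  proof -
    have "w permutes {1..n}" using w by (simp add: stabilizer_iff)
    note perm = perm_vars_prod_equal_pairs[OF this, where lam = lam]
    have "perm_vars w R = (\<Prod>(i, j)\<in>equal_pairs n lam.
        (1 - const t_var * inverse (indet (w i)) * indet (w j)) /
        (1 - inverse (indet (w i)) * indet (w j)))"
      using perm[where c = 1 and d = t_var] by (simp add: R_def const_1)
    then show ?thesis
      unfolding c_Xinv_def perm N_def
      using prod_equal_pairs_factor[where x = "\<lambda>i. indet (w i)"] by simp
  qed
  then have "(\<Sum>w\<in>stabilizer n lam. perm_vars w (c_Xinv n lam)) = const (inverse t_half ^ N * F)"
    by (simp add: sum_R const_mult flip: sum_distrib_left)
  moreover have "(\<Prod>i. t_fact (part_mult n lam i)) = F"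
    unfolding F_def by (rule prod_t_fact_part_mult)
  ultimately show ?thesis
    using sum_R unfolding poincare pairs ev longest R_def by simp
qed

end
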